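(* Let $n\ge 1$. A subset $\mathcal{B}$ of $\mathbb{E}_c^n$ is relatively compact in $(\mathbb{E}_c^n,D)$ if and only if both of the following hold: (i) $\mathcal{B}$ is bounded in $\mathbb{E}_c^n$, i.e. there exists a constant $M>0$ such that $D(u,0)\le M$ for all $u\in\mathcal{B}$; (ii) $\mathcal{B}$ is level-equicontinuous, i.e. for every $\varepsilon>0$ there exists $\delta>0$ such that for all $\alpha,\beta\in[0,1]$, if $|\alpha-\beta|<\delta$ then $\sup_{u\in\mathcal{B}}d_H([u]^\alpha,[u]^\beta)<\varepsilon$.
   Context: $K_c(\mathbb{R}^n)$ is the family of all nonempty, compact, convex subsets of $\mathbb{R}^n$, with the Hausdorff-Pompeiu metric $d_H(A,B)=\max\{\sup_{x\in A}\inf_{y\in B}\|x-y\|,\ \sup_{y\in B}\inf_{x\in A}\|x-y\|\}$. $\mathbb{E}^n$ (the space of fuzzy numbers on $\mathbb{R}^n$) is the set of all functions $u:\mathbb{R}^n\to[0,1]$ such that: (1) $u$ is normal: there is $t_0\in\mathbb{R}^n$ with $u(t_0)=1$; (2) $u$ is fuzzy convex: $u(\lambda t_1+(1-\lambda)t_2)\ge\min\{u(t_1),u(t_2)\}$ for all $t_1,t_2\in\mathbb{R}^n$, $\lambda\in[0,1]$; (3) $u$ is upper semicontinuous; (4) the closure of the support $\{t: u(t)>0\}$ is compact. For $u\in\mathbb{E}^n$ the level sets are $[u]^\alpha=\{t\in\mathbb{R}^n: u(t)\ge\alpha\}$ for $\alpha\in(0,1]$ and $[u]^0=\overline{\{t\in\mathbb{R}^n: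 u(t)>0\}}$; each $[u]^\alpha$ belongs to $K_c(\mathbb{R}^n)$. The fuzzy null set $0\in\mathbb{E}^n$ is the function equal to $1$ at $t=0$ and $0$ elsewhere. The metric on $\mathbb{E}^n$ is $D(u,v)=\sup_{\alpha\in[0,1]}d_H([u]^\alpha,[v]^\alpha)$. $\mathbb{E}_c^n$ is the set of $u\in\mathbb{E}^n$ such that the map $[0,1]\to K_c(\mathbb{R}^n)$, $\alpha\mapsto[u]^\alpha$, is continuous; it carries the metric $D$. *)

theory Defs
  imports "HOL-Analysis.Analysis"
begin

section \<open>Compact convex sets with the Hausdorff--Pompeiu metric\<close>

text \<open>Only used on nonempty bounded sets; elsewhere the real-valued suprema and infima may be
  meaningless.\<close>

definition hausdorff_dist :: "'a::real_normed_vector set \<Rightarrow> 'a set \<Rightarrow> real" where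
  "hausdorff_dist A B =
     max (SUP x\<in>A. INF y\<in>B. norm (x - y)) (SUP y\<in>B. INF x\<in>A. norm (x - y))"

typedef (overloaded) 'n::finite convex_body =
  "{A :: (real ^ 'n) set. A \<noteq> {} \<and> compact A \<and> convex A}"
  morphisms set_of_body Body
  by (rule exI[of _ "{0}"]) simp

lemma set_of_body:
  shows "set_of_body A \<noteq> {}" "compact (set_of_body A)" "convex (set_of_body A)"
  using set_of_body[of A] by auto

lemma hausdorff_dist_eq:
  assumes "A \<noteq> {}" "B \<noteq> {}"
  shows "hausdorff_dist A B = max (SUP x\<in>A. infdist x B) (SUP y\<in>B. infdist y A)"
  using assms by (simp add: hausdorff_dist_def infdist_notempty dist_norm norm_minus_commute)

lemma hausdorff_dist_le_iff:
  fixes A B :: "'a::real_normed_vector set"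
  assumes "A \<noteq> {}" "B \<noteq> {}" "compact A" "compact B"
  shows "hausdorff_dist A B \<le> r \<longleftrightarrow>
           (\<forall>x\<in>A. infdist x B \<le> r) \<and> (\<forall>y\<in>B. infdist y A \<le> r)"
proof -
  have bdd: "bdd_above ((\<lambda>x. infdist x T) ` S)" if "compact S" for S T :: "'a set"
    by (intro bounded_imp_bdd_above compact_imp_bounded compact_continuous_image that)
       (intro continuous_intros)
  show ?thesis
    using assms by (simp add: hausdorff_dist_eq cSUP_le_iff bdd)
qed

lemma hausdorff_dist_commute:
  "A \<noteq> {} \<Longrightarrow> B \<noteq> {} \<Longrightarrow> hausdorff_dist A B = hausdorff_dist B A"
  by (simp add: hausdorff_dist_eq max.commute)

lemma hausdorff_dist_infdist:
  fixes A B :: "'a::real_normed_vector set"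
  assumes "A \<noteq> {}" "B \<noteq> {}" "compact A" "compact B"
  shows "x \<in> A \<Longrightarrow> infdist x B \<le> hausdorff_dist A B"
    and "y \<in> B \<Longrightarrow> infdist y A \<le> hausdorff_dist A B"
  using hausdorff_dist_le_iff[OF assms, of "hausdorff_dist A B"] by auto

lemma hausdorff_dist_nonneg:
  fixes A B :: "'a::real_normed_vector set"
  assumes "A \<noteq> {}" "B \<noteq> {}" "compact A" "compact B"
  shows "0 \<le> hausdorff_dist A B"
proof -
  obtain x where "x \<in> A" using assms by auto
  then show ?thesis
    using hausdorff_dist_infdist(1)[OF assms] infdist_nonneg[of x B] by fastforce
qed

lemma hausdorff_dist_eq_0_iff:
  fixes A B :: "'a::real_normed_vector set"
  assumes "A \<noteq> {}" "B \<noteq> {}" "compact A" "compact B"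
  shows "hausdorff_dist A B = 0 \<longleftrightarrow> A = B"
proof -
  have cl: "closed A" "closed B" using assms by (auto simp: compact_imp_closed)
  have "hausdorff_dist A B = 0 \<longleftrightarrow> hausdorff_dist A B \<le> 0"
    using hausdorff_dist_nonneg[OF assms] by linarith
  also have "\<dots> \<longleftrightarrow> (\<forall>x\<in>A. infdist x B = 0) \<and> (\<forall>y\<in>B. infdist y A = 0)"
    unfolding hausdorff_dist_le_iff[OF assms] by (simp add: order.eq_iff infdist_nonneg)
  also have "\<dots> \<longleftrightarrow> (\<forall>x\<in>A. x \<in> B) \<and> (\<forall>y\<in>B. y \<in> A)"
    using cl assms by (simp add: in_closed_iff_infdist_zero)
  also have "\<dots> \<longleftrightarrow> A = B" by auto
  finally show ?thesis .
qed

lemma hausdorff_dist_triangle: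
  fixes A B C :: "'a::{real_normed_vector,heine_borel} set"
  assumes A: "A \<noteq> {}" "compact A" and B: "B \<noteq> {}" "compact B" and C: "C \<noteq> {}" "compact C"
  shows "hausdorff_dist A C \<le> hausdorff_dist A B + hausdorff_dist B C"
proof -
  have *: "infdist x T \<le> hausdorff_dist S B + hausdorff_dist B T"
    if S: "S \<noteq> {}" "compact S" and T: "T \<noteq> {}" "compact T" and "x \<in> S" for S T :: "'a set" and x
  proof -
    obtain y where y: "y \<in> B" "infdist x B = dist x y"
      using infdist_attains_inf[of B x] B by (auto simp: compact_imp_closed)
    have "infdist x T \<le> infdist y T + dist x y" by (rule infdist_triangle)
    also have "\<dots> \<le> hausdorff_dist B T + hausdorff_dist S B"
      using hausdorff_dist_infdist(1)[of B T y] hausdorff_dist_infdist(1)[of S B x] that B y by auto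
    finally show ?thesis by simp
  qed
  show ?thesis
    using *[OF A C] *[OF C A] A B C
    by (auto simp: hausdorff_dist_le_iff hausdorff_dist_commute[of C B]
        hausdorff_dist_commute[of B A] add.commute)
qed

instantiation convex_body :: (finite) metric_space
begin

definition dist_convex_body :: "'a convex_body \<Rightarrow> 'a convex_body \<Rightarrow> real" where
  "dist_convex_body A B = hausdorff_dist (set_of_body A) (set_of_body B)"

definition uniformity_convex_body :: "('a convex_body \<times> 'a convex_body) filter" where
  "uniformity_convex_body = (INF e\<in>{0<..}. principal {(x, y). dist x y < e})"

definition open_convex_body :: "'a convex_body set \<Rightarrow> bool" where
  "open_convex_body U \<longleftrightarrow> (\<forall>x\<in>U. \<forall>\<^sub>F (x', y) in uniformity. x' = x \<longrightarrow> y \<in> U)"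

instance
proof
  fix A B C :: "'a convex_body"
  show "dist A B = 0 \<longleftrightarrow> A = B"
    by (simp add: dist_convex_body_def hausdorff_dist_eq_0_iff set_of_body set_of_body_inject)
  show "dist A B \<le> dist A C + dist B C"
    using hausdorff_dist_triangle[of "set_of_body A" "set_of_body C" "set_of_body B"]
    by (simp add: dist_convex_body_def set_of_body hausdorff_dist_commute[of "set_of_body C"])
qed (fact uniformity_convex_body_def open_convex_body_def)+

end

section \<open>Fuzzy numbers\<close>

definition upper_semicontinuous :: "('a::topological_space \<Rightarrow> real) \<Rightarrow> bool" where
  "upper_semicontinuous f \<longleftrightarrow> (\<forall>x. \<forall>c > f x. \<forall>\<^sub>F y in nhds x. f y < c)"

definition fuzzy_numbers :: "(real ^ 'n::finite \<Rightarrow> real) set" where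
  "fuzzy_numbers =
    {u.
      range u \<subseteq> {0..1} \<and>
      (\<exists>t. u t = 1) \<and>
      (\<forall>t1 t2. \<forall>l\<in>{0..1}. u (l *\<^sub>R t1 + (1 - l) *\<^sub>R t2) \<ge> min (u t1) (u t2)) \<and>
      upper_semicontinuous u \<and>
      compact (closure {t. u t > 0})}"

lemma indicator_0_in_fuzzy_numbers: "indicator {0} \<in> (fuzzy_numbers :: (real ^ 'n::finite \<Rightarrow> real) set)"
  unfolding fuzzy_numbers_def
proof (intro CollectI conjI allI ballI)
  show "upper_semicontinuous (indicator {0::real^'n})"
    unfolding upper_semicontinuous_def
  proof (intro allI impI)
    fix x :: "real^'n" and c :: real
    assume c: "c > indicator {0} x"
    show "\<forall>\<^sub>F y in nhds x. indicator {0} y < c"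
    proof (cases "x = 0")
      case True
      then show ?thesis using c by (intro always_eventually) (auto simp: indicator_def)
    next
      case False
      then have "\<forall>\<^sub>F y in nhds x. y \<in> - {0}"
        by (intro eventually_nhds_in_open) auto
      then show ?thesis
        by eventually_elim (use c False in \<open>auto simp: indicator_def\<close>)
    qed
  qed
  have "{t. indicator {0::real^'n} t > (0::real)} = {0}" by (auto simp: indicator_def)
  then show "compact (closure {t. indicator {0::real^'n} t > (0::real)})" by simp
  show "\<exists>t. indicator {0::real^'n} t = (1::real)" by (rule exI[of _ 0]) simp
qed (auto simp: indicator_def min_def)

typedef (overloaded) 'n::finite fuzzy_number = "fuzzy_numbers :: (real ^ 'n \<Rightarrow> real) set"
  morphisms membership Fuzzy
  using indicator_0_in_fuzzy_numbers by blast

instantiation fuzzy_number :: (finite) zero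
begin

definition zero_fuzzy_number :: "'a fuzzy_number" where
  "zero_fuzzy_number = Fuzzy (indicator {0})"

instance ..

end

lemma membership_zero: "membership 0 = indicator {0}"
  by (simp add: zero_fuzzy_number_def Fuzzy_inverse indicator_0_in_fuzzy_numbers)

text \<open>Only levels \<open>\<alpha> \<in> {0..1}\<close> are meaningful; for these \<open>level_set u \<alpha>\<close> is a nonempty compact
  convex set (lemma \<open>level_set_body\<close>), so \<open>level u \<alpha>\<close> is that same set as a point of the metric
  space of convex bodies.\<close>

definition level_set :: "'n::finite fuzzy_number \<Rightarrow> real \<Rightarrow> (real ^ 'n) set" where
  "level_set u \<alpha> = (if \<alpha> = 0 then closure {t. membership u t > 0} else {t. membership u t \<ge> \<alpha>})"

definition level :: "'n::finite fuzzy_number \<Rightarrow> real \<Rightarrow> 'n convex_body" where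
  "level u \<alpha> = Body (level_set u \<alpha>)"

lemma membership_fuzzy:
  shows "range (membership u) \<subseteq> {0..1}" "\<exists>t. membership u t = 1"
    "l \<in> {0..1} \<Longrightarrow> min (membership u t1) (membership u t2) \<le> membership u (l *\<^sub>R t1 + (1 - l) *\<^sub>R t2)"
    "upper_semicontinuous (membership u)" "compact (closure {t. membership u t > 0})"
  using membership[of u] unfolding fuzzy_numbers_def by blast+

lemma membership_bounds: "0 \<le> membership u t" "membership u t \<le> 1"
  using membership_fuzzy(1)[of u] by (auto simp: image_subset_iff)

lemma level_set_subset:
  assumes "\<alpha> \<in> {0..1}" shows "level_set u \<alpha> \<subseteq> level_set u 0"
  using assms closure_subset[of "{t. membership u t > 0}"] by (auto simp: level_set_def subset_iff)

lemma level_set_body: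
  assumes "\<alpha> \<in> {0..1}"
  shows "level_set u \<alpha> \<noteq> {}" "compact (level_set u \<alpha>)" "convex (level_set u \<alpha>)"
proof -
  obtain t where t: "membership u t = 1" using membership_fuzzy(2) by blast
  then have "t \<in> level_set u \<alpha>"
    using assms closure_subset[of "{t. membership u t > 0}"] by (auto simp: level_set_def)
  then show "level_set u \<alpha> \<noteq> {}" by auto
  have *: "min (membership u x) (membership u y) \<le> membership u (a *\<^sub>R x + b *\<^sub>R y)"
    if "0 \<le> a" "0 \<le> b" "a + b = 1" for x y a b
  proof -
    have "b = 1 - a" "a \<in> {0..1}" using that by auto
    then show ?thesis using membership_fuzzy(3) by metis
  qed
  have "convex {t. membership u t > 0}"
    unfolding convex_def by (auto intro!: less_le_trans[OF _ *])
  moreover have "convex {t. membership u t \<ge> \<alpha>}"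
    unfolding convex_def by (auto intro!: order_trans[OF _ *])
  ultimately show "convex (level_set u \<alpha>)" by (auto simp: level_set_def convex_closure)
  show "compact (level_set u \<alpha>)"
  proof (cases "\<alpha> = 0")
    case True
    then show ?thesis using membership_fuzzy(5)[of u] by (simp add: level_set_def)
  next
    case False
    have "open {t. membership u t < \<alpha>}"
      unfolding open_subopen[of "{t. membership u t < \<alpha>}"]
    proof
      fix x assume "x \<in> {t. membership u t < \<alpha>}"
      then have "\<forall>\<^sub>F y in nhds x. membership u y < \<alpha>"
        using membership_fuzzy(4)[of u] by (auto simp: upper_semicontinuous_def)
      then show "\<exists>T. open T \<and> x \<in> T \<and> T \<subseteq> {t. membership u t < \<alpha>}"
        by (auto simp: eventually_nhds)
    qed
    moreover have "level_set u \<alpha> = - {t. membership u t < \<alpha>}"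
      using False by (auto simp: level_set_def)
    ultimately have "closed (level_set u \<alpha>)" by auto
    moreover have "compact (level_set u 0)" using membership_fuzzy(5)[of u] by (simp add: level_set_def)
    ultimately show ?thesis
      using compact_Int_closed[of "level_set u 0" "level_set u \<alpha>"] level_set_subset[OF assms, of u]
      by (simp add: Int_absorb1)
  qed
qed

lemma set_of_body_level: "\<alpha> \<in> {0..1} \<Longrightarrow> set_of_body (level u \<alpha>) = level_set u \<alpha>"
  unfolding level_def by (intro Body_inverse CollectI conjI level_set_body)

lemma fuzzy_number_eqI:
  assumes "\<And>\<alpha>. \<alpha> \<in> {0..1} \<Longrightarrow> level u \<alpha> = level v \<alpha>"
  shows "u = v"
proof -
  have le: "membership u t \<le> membership v t"
    if "\<And>\<alpha>. \<alpha> \<in> {0..1} \<Longrightarrow> level_set u \<alpha> = level_set v \<alpha>" for u v :: "'n::finite fuzzy_number" and t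
  proof (cases "membership u t = 0")
    case False
    have "membership u t \<in> {0..1}" by (simp add: membership_bounds)
    from that[OF this] False show ?thesis by (auto simp: level_set_def)
  qed (simp add: membership_bounds)
  have "level_set u \<alpha> = level_set v \<alpha>" if "\<alpha> \<in> {0..1}" for \<alpha>
    using assms[OF that] set_of_body_level[OF that] by metis
  then have "membership u = membership v"
    by (intro ext order.antisym le) auto
  then show ?thesis by (simp add: membership_inject)
qed

lemma bdd_above_level_dist: "bdd_above ((\<lambda>\<alpha>. dist (level u \<alpha>) (level v \<alpha>)) ` {0..1})"
proof -
  have "bounded (level_set u 0 \<union> level_set v 0)"
    by (simp add: compact_imp_bounded level_set_body)
  then obtain e where e: "\<And>x y. x \<in> level_set u 0 \<union> level_set v 0 \<Longrightarrow>
      y \<in> level_set u 0 \<union> level_set v 0 \<Longrightarrow> dist x y \<le> e"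
    unfolding bounded_two_points by blast
  have "dist (level u \<alpha>) (level v \<alpha>) \<le> e" if \<alpha>: "\<alpha> \<in> {0..1}" for \<alpha>
  proof -
    have sub: "level_set u \<alpha> \<subseteq> level_set u 0" "level_set v \<alpha> \<subseteq> level_set v 0"
      using level_set_subset \<alpha> by auto
    have ne: "level_set u \<alpha> \<noteq> {}" "level_set v \<alpha> \<noteq> {}"
      using level_set_body \<alpha> by auto
    have *: "infdist x T \<le> e"
      if T: "x \<in> level_set u 0 \<union> level_set v 0" "T \<subseteq> level_set u 0 \<union> level_set v 0" "T \<noteq> {}" for x T
    proof -
      obtain y where "y \<in> T" using T by auto
      then show ?thesis using e[of x y] T by (auto intro: infdist_le2)
    qed
    have "infdist x (level_set v \<alpha>) \<le> e" if "x \<in> level_set u \<alpha>" for x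
      by (rule *) (use ne sub that in auto)
    moreover have "infdist x (level_set u \<alpha>) \<le> e" if "x \<in> level_set v \<alpha>" for x
      by (rule *) (use ne sub that in auto)
    ultimately show ?thesis
      by (simp add: dist_convex_body_def set_of_body_level[OF \<alpha>] hausdorff_dist_le_iff
          level_set_body[OF \<alpha>])
  qed
  then show ?thesis by (intro bdd_aboveI2)
qed

instantiation fuzzy_number :: (finite) metric_space
begin

definition dist_fuzzy_number :: "'a fuzzy_number \<Rightarrow> 'a fuzzy_number \<Rightarrow> real" where
  "dist_fuzzy_number u v = (SUP \<alpha>\<in>{0..1}. dist (level u \<alpha>) (level v \<alpha>))"

definition uniformity_fuzzy_number :: "('a fuzzy_number \<times> 'a fuzzy_number) filter" where
  "uniformity_fuzzy_number = (INF e\<in>{0<..}. principal {(x, y). dist x y < e})"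

definition open_fuzzy_number :: "'a fuzzy_number set \<Rightarrow> bool" where
  "open_fuzzy_number U \<longleftrightarrow> (\<forall>x\<in>U. \<forall>\<^sub>F (x', y) in uniformity. x' = x \<longrightarrow> y \<in> U)"

instance
proof
  fix u v w :: "'a fuzzy_number"
  have upper: "dist (level u \<alpha>) (level v \<alpha>) \<le> dist u v" if "\<alpha> \<in> {0..1}"
    for u v :: "'a fuzzy_number" and \<alpha>
    unfolding dist_fuzzy_number_def by (rule cSUP_upper[OF that bdd_above_level_dist])
  show "dist u v = 0 \<longleftrightarrow> u = v"
  proof
    assume "dist u v = 0"
    then show "u = v"
      using upper[of _ u v] by (intro fuzzy_number_eqI) simp
  qed (simp add: dist_fuzzy_number_def)
  show "dist u v \<le> dist u w + dist v w"
    unfolding dist_fuzzy_number_def[of u v]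
  proof (rule cSUP_least)
    fix \<alpha> :: real assume "\<alpha> \<in> {0..1}"
    then show "dist (level u \<alpha>) (level v \<alpha>) \<le> dist u w + dist v w"
      using upper[of \<alpha> u w] upper[of \<alpha> v w] dist_triangle2[of "level u \<alpha>" "level v \<alpha>" "level w \<alpha>"]
      by linarith
  qed simp
qed (fact uniformity_fuzzy_number_def open_fuzzy_number_def)+

end

definition continuous_fuzzy_numbers :: "'n::finite fuzzy_number set" where
  "continuous_fuzzy_numbers = {u. continuous_on {0..1} (level u)}"

end

theory Submission
  imports Defs "HOL-Complex_Analysis.Great_Picard"
begin

text \<open>A compact set is encoded by its distance function, and the Hausdorff distance of two compact
  subsets of \<open>K\<close> is the supremum over \<open>K\<close> of the difference of their distance functions. A bounded
  level-equicontinuous sequence of fuzzy numbers thus becomes an equicontinuous sequence of real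
  functions \<open>(\<alpha>, x) \<mapsto> infdist x (level_set u \<alpha>)\<close> on \<open>{0..1} \<times> cball 0 M\<close>, to which the
  Arzela--Ascoli theorem applies. The zero sets of the limit function are the level sets of a fuzzy
  number, which is the limit of the subsequence. For the converse, \<open>(u, \<alpha>) \<mapsto> level u \<alpha>\<close> is jointly
  continuous, hence uniformly continuous on the product of a compact set with \<open>{0..1}\<close>.\<close>

section \<open>Distance functions of compact sets\<close>

text \<open>From \<open>x\<close> go to a nearest point of one set and on to the other set; the
  second leg costs at most the Hausdorff distance.\<close>

lemma infdist_diff_le_hausdorff_dist:
  fixes A B :: "'a::{real_normed_vector,heine_borel} set"
  assumes A: "A \<noteq> {}" "compact A" and B: "B \<noteq> {}" "compact B"
  shows "\<bar>infdist x A - infdist x B\<bar> \<le> hausdorff_dist A B"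
proof -
  have *: "infdist x T \<le> infdist x S + hausdorff_dist S T"
    if S: "S \<noteq> {}" "compact S" and T: "T \<noteq> {}" "compact T" for S T :: "'a set"
  proof -
    obtain y where y: "y \<in> S" "infdist x S = dist x y"
      using infdist_attains_inf[of S x] S by (auto simp: compact_imp_closed)
    have "infdist x T \<le> infdist y T + dist x y" by (rule infdist_triangle)
    then show ?thesis
      using hausdorff_dist_infdist(1)[of S T y] S T y by simp
  qed
  show ?thesis
    using *[OF A B] *[OF B A] hausdorff_dist_commute[OF A(1) B(1)] by linarith
qed

text \<open>At a point of \<open>A\<close> the difference of the distance functions is, up to sign,
  the distance to \<open>B\<close>, and vice versa, so a bound on a common superset \<open>K\<close>
  controls both one-sided excesses.\<close>

lemma hausdorff_dist_leI:
  fixes A B :: "'a::real_normed_vector set"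
  assumes "A \<noteq> {}" "compact A" "B \<noteq> {}" "compact B" "A \<subseteq> K" "B \<subseteq> K"
    and "\<And>x. x \<in> K \<Longrightarrow> \<bar>infdist x A - infdist x B\<bar> \<le> r"
  shows "hausdorff_dist A B \<le> r"
proof -
  have "infdist x B \<le> r" if "x \<in> A" for x
    using assms(7)[of x] assms(5) that by (auto simp: infdist_nonneg)
  moreover have "infdist x A \<le> r" if "x \<in> B" for x
    using assms(7)[of x] assms(6) that by (auto simp: infdist_nonneg)
  ultimately show ?thesis
    by (simp add: hausdorff_dist_le_iff assms)
qed

text \<open>The same combination of nearest points of \<open>x\<close> and \<open>y\<close> stays in
  \<open>A\<close> and serves as a competitor.\<close>

lemma infdist_convex_combination_le:
  fixes A :: "'a::{real_normed_vector,heine_borel} set"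
  assumes "A \<noteq> {}" "closed A" "convex A" and ab: "0 \<le> a" "0 \<le> b" "a + b = 1"
  shows "infdist (a *\<^sub>R x + b *\<^sub>R y) A \<le> a * infdist x A + b * infdist y A"
proof -
  obtain x' where x': "x' \<in> A" "infdist x A = dist x x'"
    using infdist_attains_inf[of A x] assms by auto
  obtain y' where y': "y' \<in> A" "infdist y A = dist y y'"
    using infdist_attains_inf[of A y] assms by auto
  have "infdist (a *\<^sub>R x + b *\<^sub>R y) A \<le> dist (a *\<^sub>R x + b *\<^sub>R y) (a *\<^sub>R x' + b *\<^sub>R y')"
    using assms x' y' by (intro infdist_le convexD)
  also have "\<dots> = norm (a *\<^sub>R (x - x') + b *\<^sub>R (y - y'))"
    by (simp add: dist_norm algebra_simps)
  also have "\<dots> \<le> a * dist x x' + b * dist y y'"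
    using ab by (metis (no_types, lifting) abs_of_nonneg dist_norm norm_scaleR norm_triangle_ineq)
  finally show ?thesis by (simp add: x' y')
qed

text \<open>Nearest points to \<open>x\<close> in the sets \<open>A k\<close> accumulate at a zero
  \<open>z\<close> of \<open>g\<close> with \<open>dist x z = g x\<close>, which gives one
  inequality; the other holds because \<open>g\<close> inherits the Lipschitz constant 1. So a
  pointwise limit of distance functions is again a distance function on \<open>K\<close>.\<close>

lemma infdist_limit:
  fixes A :: "nat \<Rightarrow> 'a::heine_borel set" and g :: "'a \<Rightarrow> real"
  assumes K: "compact K" and A: "\<And>k. A k \<noteq> {}" "\<And>k. closed (A k)" "\<And>k. A k \<subseteq> K"
    and lim: "\<And>x. x \<in> K \<Longrightarrow> (\<lambda>k. infdist x (A k)) \<longlonglongrightarrow> g x"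
    and x: "x \<in> K"
  shows "\<exists>z\<in>K. g z = 0" and "infdist x {z \<in> K. g z = 0} = g x"
proof -
  have "\<exists>y. y \<in> A k \<and> infdist x (A k) = dist x y" for k
    using infdist_attains_inf[of "A k" x] A by metis
  then obtain y where y: "\<And>k. y k \<in> A k" "\<And>k. infdist x (A k) = dist x (y k)"
    by metis
  then obtain z r where z: "z \<in> K" "strict_mono r" "(y \<circ> r) \<longlonglongrightarrow> z"
    using K A(3) unfolding compact_def by (metis subsetD)
  have "(\<lambda>k. infdist z (A (r k))) \<longlonglongrightarrow> 0"
  proof (rule tendsto_sandwich[OF _ _ tendsto_const])
    show "\<forall>\<^sub>F k in sequentially. infdist z (A (r k)) \<le> dist ((y \<circ> r) k) z"
      using y(1) by (auto intro!: always_eventually infdist_le simp: dist_commute[of _ z])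
    show "(\<lambda>k. dist ((y \<circ> r) k) z) \<longlonglongrightarrow> 0"
      using z(3) by (simp only: tendsto_dist_iff[symmetric])
  qed (simp add: infdist_nonneg)
  moreover have "(\<lambda>k. infdist z (A (r k))) \<longlonglongrightarrow> g z"
    using LIMSEQ_subseq_LIMSEQ[OF lim[OF z(1)] z(2)] by (simp add: o_def)
  ultimately have gz: "g z = 0" by (rule LIMSEQ_unique[symmetric])
  have "(\<lambda>k. infdist x (A (r k))) \<longlonglongrightarrow> g x"
    using LIMSEQ_subseq_LIMSEQ[OF lim[OF x] z(2)] by (simp add: o_def)
  moreover have "(\<lambda>k. dist x ((y \<circ> r) k)) \<longlonglongrightarrow> dist x z"
    using z(3) by (intro tendsto_intros)
  ultimately have gx: "dist x z = g x"
    by (simp add: y(2) LIMSEQ_unique)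
  show ex: "\<exists>z\<in>K. g z = 0" using z gz by auto
  have "infdist x {z \<in> K. g z = 0} \<le> g x"
    using z gz gx by (intro infdist_le2[of z]) auto
  moreover have "g x \<le> dist x w" if w: "w \<in> K" "g w = 0" for w
  proof -
    have "g x \<le> g w + dist x w"
      using lim[OF x] tendsto_add[OF lim[OF w(1)] tendsto_const]
      by (rule LIMSEQ_le) (auto intro: infdist_triangle)
    then show ?thesis using w by simp
  qed
  then have "g x \<le> infdist x {z \<in> K. g z = 0}"
    using ex by (subst infdist_notempty) (auto intro!: cINF_greatest)
  ultimately show "infdist x {z \<in> K. g z = 0} = g x" by simp
qed

section \<open>Fuzzy numbers with prescribed level sets\<close>

text \<open>The membership of \<open>t\<close> is the largest level whose set contains
  \<open>t\<close>. Continuity of the distance in \<alpha> does two jobs: the supremum is attained,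
  and points of positive membership are dense in \<open>A 0\<close>.\<close>

lemma fuzzy_number_of_levels:
  fixes A :: "real \<Rightarrow> (real ^ 'n::finite) set"
  assumes A: "\<And>\<alpha>. \<alpha> \<in> {0..1} \<Longrightarrow> A \<alpha> \<noteq> {} \<and> compact (A \<alpha>) \<and> convex (A \<alpha>)"
    and mono: "\<And>\<alpha> \<beta>. 0 \<le> \<alpha> \<Longrightarrow> \<alpha> \<le> \<beta> \<Longrightarrow> \<beta> \<le> 1 \<Longrightarrow> A \<beta> \<subseteq> A \<alpha>"
    and cont: "\<And>t. t \<in> A 0 \<Longrightarrow> continuous_on {0..1} (\<lambda>\<alpha>. infdist t (A \<alpha>))"
  obtains u where "\<And>\<alpha>. \<alpha> \<in> {0..1} \<Longrightarrow> level_set u \<alpha> = A \<alpha>"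
proof -
  define I where "I t = {\<alpha> \<in> {0..1}. t \<in> A \<alpha>}" for t
  \<comment> \<open>Outside \<open>A 0\<close> the set \<open>I t\<close> is empty by monotonicity,
    so the value 0 is prescribed.\<close>
  define m where "m t = (if t \<in> A 0 then Sup (I t) else 0)" for t
  have in_A: "t \<in> A \<alpha> \<longleftrightarrow> infdist t (A \<alpha>) = 0" if "\<alpha> \<in> {0..1}" for t \<alpha>
    using A[OF that] by (simp add: in_closed_iff_infdist_zero compact_imp_closed)
  have I_max: "Sup (I t) \<in> I t" "bdd_above (I t)" if t: "t \<in> A 0" for t
  proof -
    \<comment> \<open>As the zero set of a continuous function on \<open>{0..1}\<close>,
      \<open>I t\<close> is closed and contains its supremum.\<close>
    have "I t = {\<alpha> \<in> {0..1}. infdist t (A \<alpha>) = 0}" using in_A by (auto simp: I_def)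
    then have "closed (I t)"
      using continuous_closed_preimage_constant[OF cont[OF t], of 0] by simp
    moreover show "bdd_above (I t)" by (auto simp: I_def)
    moreover have "0 \<in> I t" using t by (simp add: I_def)
    ultimately show "Sup (I t) \<in> I t" using closed_contains_Sup by blast
  qed
  have m_bounds: "0 \<le> m t" "m t \<le> 1" for t
    using I_max(1)[of t] by (auto simp: m_def I_def)
  \<comment> \<open>Level 0 is excluded: \<open>m t \<ge> 0\<close> holds everywhere, so
    \<open>A 0\<close> has to be recovered as the closure of the support.\<close>
  have m_ge: "m t \<ge> \<alpha> \<longleftrightarrow> t \<in> A \<alpha>" if \<alpha>: "0 < \<alpha>" "\<alpha> \<le> 1" for t \<alpha>
  proof
    assume "m t \<ge> \<alpha>"
    then show "t \<in> A \<alpha>"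
      using \<alpha> I_max(1)[of t] mono[of \<alpha> "m t"] by (auto simp: m_def I_def split: if_splits)
  next
    assume t: "t \<in> A \<alpha>"
    moreover have "t \<in> A 0" using t mono[of 0 \<alpha>] \<alpha> by auto
    ultimately show "m t \<ge> \<alpha>"
      using \<alpha> I_max(2)[of t] by (auto simp: m_def I_def intro!: cSup_upper)
  qed
  have support: "closure {t. m t > 0} = A 0"
  proof
    have "closed (A 0)" using A[of 0] by (simp add: compact_imp_closed)
    then show "closure {t. m t > 0} \<subseteq> A 0"
      by (intro closure_minimal) (auto simp: m_def split: if_splits)
    show "A 0 \<subseteq> closure {t. m t > 0}"
    proof
      \<comment> \<open>By continuity at level 0, \<open>t\<close> is close to
        \<open>A \<alpha>\<close> for small positive \<alpha>, and the points of
        \<open>A \<alpha>\<close> have positive membership.\<close>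
      fix t assume t: "t \<in> A 0"
      show "t \<in> closure {t. m t > 0}"
        unfolding closure_approachable
      proof (intro allI impI)
        fix e :: real assume "e > 0"
        with cont[OF t] obtain d where d: "d > 0"
          "\<And>\<alpha>. \<alpha> \<in> {0..1} \<Longrightarrow> dist \<alpha> 0 < d \<Longrightarrow> dist (infdist t (A \<alpha>)) (infdist t (A 0)) < e"
          unfolding continuous_on_iff by (metis atLeastAtMost_iff order_refl zero_le_one)
        define \<alpha> where "\<alpha> = min 1 (d / 2)"
        have \<alpha>: "\<alpha> \<in> {0..1}" "0 < \<alpha>" "dist \<alpha> 0 < d" using d(1) by (auto simp: \<alpha>_def min_def)
        then have "infdist t (A \<alpha>) < e" using d(2)[of \<alpha>] t by simp
        moreover obtain y where y: "y \<in> A \<alpha>" "infdist t (A \<alpha>) = dist t y"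
          using infdist_attains_inf[of "A \<alpha>" t] A[OF \<alpha>(1)] by (auto simp: compact_imp_closed)
        moreover have "m y > 0" using m_ge[of \<alpha> y] \<alpha> y by simp
        ultimately show "\<exists>y\<in>{t. m t > 0}. dist y t < e" by (auto simp: dist_commute)
      qed
    qed
  qed
  have "m \<in> fuzzy_numbers"
    unfolding fuzzy_numbers_def
  proof (intro CollectI conjI allI ballI)
    show "range m \<subseteq> {0..1}" using m_bounds by auto
    obtain t where "t \<in> A 1" using A[of 1] by auto
    then show "\<exists>t. m t = 1" using m_ge[of 1 t] m_bounds[of t] by (auto intro!: exI[of _ t])
    show "compact (closure {t. m t > 0})" using support A[of 0] by simp
  next
    fix t1 t2 :: "real ^ 'n" and l :: real assume l: "l \<in> {0..1}"
    \<comment> \<open>For positive \<open>c\<close> both points lie in the convex set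
      \<open>A c\<close>; otherwise nonnegativity of \<open>m\<close> suffices.\<close>
    define c where "c = min (m t1) (m t2)"
    have "c \<le> m (l *\<^sub>R t1 + (1 - l) *\<^sub>R t2)"
    proof (cases "c > 0")
      case True
      have "c \<le> m t1" "c \<le> m t2" by (auto simp: c_def)
      moreover from this have c: "0 < c" "c \<le> 1" using True m_bounds(2)[of t1] by auto
      ultimately have "t1 \<in> A c" "t2 \<in> A c" using m_ge by auto
      moreover have "convex (A c)" using A[of c] c by simp
      ultimately have "l *\<^sub>R t1 + (1 - l) *\<^sub>R t2 \<in> A c" using l by (intro convexD) auto
      then show ?thesis using m_ge[OF c] by blast
    next
      case False
      then show ?thesis using m_bounds(1)[of "l *\<^sub>R t1 + (1 - l) *\<^sub>R t2"] by linarith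
    qed
    then show "min (m t1) (m t2) \<le> m (l *\<^sub>R t1 + (1 - l) *\<^sub>R t2)" by (simp only: c_def)
  next
    show "upper_semicontinuous m"
      unfolding upper_semicontinuous_def
    proof (intro allI impI)
      fix x c assume c: "c > m x"
      then have "c > 0" using m_bounds(1)[of x] by linarith
      show "\<forall>\<^sub>F y in nhds x. m y < c"
      \<comment> \<open>Up to \<open>c = 1\<close> the strict sublevel set is the complement of the
        closed set \<open>A c\<close>; beyond 1 it is the whole space.\<close>
      proof (cases "c \<le> 1")
        case True
        have "closed (A c)" using A[of c] True \<open>c > 0\<close> by (simp add: compact_imp_closed)
        moreover have "m y < c \<longleftrightarrow> y \<in> - A c" for y
          using m_ge[OF \<open>c > 0\<close> True, of y] by auto
        ultimately show ?thesis
          using c eventually_nhds_in_open[of "- A c" x] by (simp add: open_Compl)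
      next
        case False
        then have "m y < c" for y using m_bounds(2)[of y] by linarith
        then show ?thesis by simp
      qed
    qed
  qed
  then have "membership (Fuzzy m) = m" by (rule Fuzzy_inverse)
  then have "level_set (Fuzzy m) \<alpha> = A \<alpha>" if "\<alpha> \<in> {0..1}" for \<alpha>
    using that support m_ge[of \<alpha>] by (auto simp: level_set_def)
  then show thesis by (rule that)
qed

section \<open>The metric on fuzzy numbers\<close>

lemma dist_level:
  assumes "\<alpha> \<in> {0..1}" "\<beta> \<in> {0..1}"
  shows "dist (level u \<alpha>) (level v \<beta>) = hausdorff_dist (level_set u \<alpha>) (level_set v \<beta>)"
  using assms by (simp add: dist_convex_body_def set_of_body_level)

lemma dist_level_le:
  assumes "\<alpha> \<in> {0..1}"
  shows "dist (level u \<alpha>) (level v \<alpha>) \<le> dist u v"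
  unfolding dist_fuzzy_number_def by (rule cSUP_upper[OF assms bdd_above_level_dist])

lemma dist_fuzzy_number_leI:
  assumes "\<And>\<alpha>. \<alpha> \<in> {0..1} \<Longrightarrow> dist (level u \<alpha>) (level v \<alpha>) \<le> r"
  shows "dist u v \<le> r"
  unfolding dist_fuzzy_number_def by (rule cSUP_least) (use assms in auto)

text \<open>The level sets of the fuzzy null set are all \<open>{0}\<close>, and the distance to
  \<open>{0}\<close> is the norm.\<close>

lemma level_set_subset_cball:
  fixes u :: "'a::finite fuzzy_number"
  assumes "\<alpha> \<in> {0..1}"
  shows "level_set u \<alpha> \<subseteq> cball 0 (dist u 0)"
proof
  fix x :: "real ^ 'a" assume x: "x \<in> level_set u \<alpha>"
  have "level_set 0 \<alpha> = ({0} :: (real ^ 'a) set)"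
  proof (cases "\<alpha> = 0")
    case True
    have "{t. indicator {0 :: real ^ 'a} t > (0::real)} = {0}" by (auto simp: indicator_def)
    then show ?thesis using True by (simp add: level_set_def membership_zero)
  next
    case False
    then show ?thesis using assms by (auto simp: level_set_def membership_zero indicator_def)
  qed
  then have "norm x \<le> hausdorff_dist (level_set u \<alpha>) (level_set (0 :: 'a fuzzy_number) \<alpha>)"
    using hausdorff_dist_infdist(1)[of "level_set u \<alpha>" "level_set 0 \<alpha>" x] x
      level_set_body[OF assms, of u] by simp
  also have "\<dots> \<le> dist u 0"
    using dist_level_le[OF assms, of u 0] by (simp only: dist_level[OF assms assms])
  finally show "x \<in> cball 0 (dist u 0)" by simp
qed

lemma continuous_on_level:
  assumes "\<alpha> \<in> {0..1}"
  shows "continuous_on S (\<lambda>u. level u \<alpha>)"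
  unfolding continuous_on_iff using dist_level_le[OF assms] by (meson le_less_trans)

text \<open>Moving \<open>u\<close> changes all levels by at most \<open>dist\<close>, uniformly in
  \<alpha>, so continuity in \<alpha> at the fixed \<open>u\<close> suffices.\<close>

lemma continuous_on_level_pair:
  fixes S :: "'a::finite fuzzy_number set"
  assumes "S \<subseteq> continuous_fuzzy_numbers"
  shows "continuous_on (S \<times> {0..1}) (\<lambda>(u, \<alpha>). level u \<alpha>)"
  unfolding continuous_on_iff
proof (intro ballI allI impI, clarify)
  fix u :: "'a fuzzy_number" and \<alpha> e :: real assume u: "u \<in> S" and \<alpha>: "\<alpha> \<in> {0..1}" and "e > 0"
  have "continuous_on {0..1} (level u)"
    using assms u by (auto simp: continuous_fuzzy_numbers_def)
  then obtain d where d: "d > 0"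
    "\<And>\<beta>. \<beta> \<in> {0..1} \<Longrightarrow> dist \<beta> \<alpha> < d \<Longrightarrow> dist (level u \<beta>) (level u \<alpha>) < e / 2"
    using \<alpha> \<open>e > 0\<close> unfolding continuous_on_iff by (metis half_gt_zero)
  show "\<exists>d>0. \<forall>x'\<in>S \<times> {0..1}. dist x' (u, \<alpha>) < d \<longrightarrow>
      dist (case x' of (u, \<alpha>) \<Rightarrow> level u \<alpha>) (level u \<alpha>) < e"
  proof (intro exI[of _ "min d (e / 2)"] conjI ballI impI, goal_cases)
    case 1
    then show ?case using d \<open>e > 0\<close> by simp
  next
    case (2 x')
    obtain v \<beta> where x': "x' = (v, \<beta>)" by force
    have "dist v u < e / 2" "dist \<beta> \<alpha> < d"
      using 2 dist_fst_le[of x' "(u, \<alpha>)"] dist_snd_le[of x' "(u, \<alpha>)"] by (auto simp: x')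
    then show ?case
      using 2 d(2)[of \<beta>] dist_level_le[of \<beta> v u]
        dist_triangle[of "level v \<beta>" "level u \<alpha>" "level u \<beta>"]
      by (simp add: x')
  qed
qed

text \<open>Convergence in the supremum metric is uniform convergence of the level maps, which
  preserves continuity.\<close>

lemma closed_continuous_fuzzy_numbers: "closed continuous_fuzzy_numbers"
  unfolding closed_sequential_limits
proof (intro allI impI, elim conjE)
  fix f :: "nat \<Rightarrow> 'a fuzzy_number" and u
  assume f: "\<forall>n. f n \<in> continuous_fuzzy_numbers" and lim: "f \<longlonglongrightarrow> u"
  have "uniform_limit {0..1} (\<lambda>n. level (f n)) (level u) sequentially"
  proof (rule uniform_limitI)
    fix e :: real assume "e > 0"
    from tendstoD[OF lim this]
    show "\<forall>\<^sub>F n in sequentially. \<forall>\<alpha>\<in>{0..1}. dist (level (f n) \<alpha>) (level u \<alpha>) < e"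
      by eventually_elim (blast intro: le_less_trans dist_level_le)
  qed
  then have "continuous_on {0..1} (level u)"
    using f by (intro uniform_limit_theorem) (auto simp: continuous_fuzzy_numbers_def)
  then show "u \<in> continuous_fuzzy_numbers" by (simp add: continuous_fuzzy_numbers_def)
qed

section \<open>Compactness\<close>

text \<open>The nonstrict bound in \<open>equi\<close> survives limits in \<open>u\<close>, so
  sequences from a closure are covered too.\<close>

lemma fuzzy_number_convergent_subsequence:
  fixes u :: "nat \<Rightarrow> 'n::finite fuzzy_number"
  assumes bound: "\<And>k. dist (u k) 0 \<le> M"
    and equi: "\<And>e. e > 0 \<Longrightarrow> \<exists>d>0. \<forall>k. \<forall>\<alpha>\<in>{0..1}. \<forall>\<beta>\<in>{0..1}. \<bar>\<alpha> - \<beta>\<bar> < d \<longrightarrow>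
                 dist (level (u k) \<alpha>) (level (u k) \<beta>) \<le> e"
  obtains v r where "strict_mono r" "(u \<circ> r) \<longlonglongrightarrow> v"
proof -
  \<comment> \<open>A ball contains all level sets and is convex, so convex combinations stay in the
    domain of the limit function.\<close>
  define K where "K = cball (0 :: real ^ 'n) M"
  define F where "F k p = infdist (snd p) (level_set (u k) (fst p))" for k and p :: "real \<times> (real ^ 'n)"
  have K: "compact K" "convex K" by (simp_all add: K_def)
  have sub: "level_set (u k) \<alpha> \<subseteq> K" if "\<alpha> \<in> {0..1}" for k \<alpha>
    using level_set_subset_cball[OF that, of "u k"] bound[of k] by (auto simp: K_def)
  have equi_F: "\<exists>d>0. \<forall>n q. q \<in> {0..1} \<times> K \<and> norm (p - q) < d \<longrightarrow> norm (F n p - F n q) < e"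
    if p: "p \<in> {0..1} \<times> K" and "e > 0" for p e
  proof -
    obtain d where d: "d > 0" "\<And>k \<alpha> \<beta>. \<alpha> \<in> {0..1} \<Longrightarrow> \<beta> \<in> {0..1} \<Longrightarrow> \<bar>\<alpha> - \<beta>\<bar> < d \<Longrightarrow>
        dist (level (u k) \<alpha>) (level (u k) \<beta>) \<le> e / 2"
      using equi[of "e / 2"] \<open>e > 0\<close> by auto
    \<comment> \<open>Half of \<open>e\<close> pays for the change of level, half for the change of
      point, distance functions being 1-Lipschitz.\<close>
    have "norm (F n p - F n q) < e"
      if q: "q \<in> {0..1} \<times> K" and pq: "norm (p - q) < min d (e / 2)" for n q
    proof -
      obtain \<alpha> x where p_eq: "p = (\<alpha>, x)" by force
      obtain \<beta> y where q_eq: "q = (\<beta>, y)" by force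
      have \<alpha>: "\<alpha> \<in> {0..1}" and \<beta>: "\<beta> \<in> {0..1}" using p q by (auto simp: p_eq q_eq)
      have "\<bar>\<alpha> - \<beta>\<bar> < d" "dist x y < e / 2"
        using pq dist_fst_le[of p q] dist_snd_le[of p q]
        by (auto simp: p_eq q_eq dist_norm)
      moreover have "\<bar>infdist y (level_set (u n) \<alpha>) - infdist y (level_set (u n) \<beta>)\<bar>
          \<le> dist (level (u n) \<alpha>) (level (u n) \<beta>)"
        unfolding dist_level[OF \<alpha> \<beta>]
        by (intro infdist_diff_le_hausdorff_dist level_set_body \<alpha> \<beta>)
      moreover have "\<bar>infdist x (level_set (u n) \<alpha>) - infdist y (level_set (u n) \<alpha>)\<bar> \<le> dist x y"
        by (rule infdist_triangle_abs)
      ultimately show ?thesis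
        using d(2)[of \<alpha> \<beta> n] \<alpha> \<beta> by (simp add: F_def p_eq q_eq)
    qed
    then show ?thesis using d(1) \<open>e > 0\<close> by (intro exI[of _ "min d (e / 2)"]) auto
  qed
  \<comment> \<open>\<open>2 * M\<close> bounds the diameter of the ball \<open>K\<close>.\<close>
  have bound_F: "norm (F k p) \<le> 2 * M" if p: "p \<in> {0..1} \<times> K" for k p
  proof -
    obtain y where "y \<in> level_set (u k) (fst p)"
      using level_set_body(1)[of "fst p" "u k"] p by auto
    moreover from this have "y \<in> K" "snd p \<in> K"
      using sub[of "fst p" k] p by auto
    then have "norm y \<le> M" "norm (snd p) \<le> M"
      by (simp_all add: K_def)
    ultimately have "F k p \<le> 2 * M"
      unfolding F_def using norm_triangle_ineq4[of "snd p" y]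
      by (intro infdist_le2[of y]) (auto simp: dist_norm)
    then show ?thesis by (simp add: F_def infdist_nonneg)
  qed
  obtain g r where g: "continuous_on ({0..1} \<times> K) g" and r: "strict_mono (r :: nat \<Rightarrow> nat)"
    and unif: "\<And>e. 0 < e \<Longrightarrow> \<exists>N. \<forall>n p. n \<ge> N \<and> p \<in> {0..1} \<times> K \<longrightarrow> norm (F (r n) p - g p) < e"
    by (rule Arzela_Ascoli[of "{0..1} \<times> K" F "2 * M"])
       (use K bound_F equi_F in \<open>auto intro: compact_Times\<close>)
  have lim: "(\<lambda>k. infdist x (level_set (u (r k)) \<alpha>)) \<longlonglongrightarrow> g (\<alpha>, x)"
    if "\<alpha> \<in> {0..1}" "x \<in> K" for \<alpha> x
    unfolding LIMSEQ_iff
  proof (intro allI impI)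
    fix e :: real assume "e > 0"
    then obtain N where N: "\<And>n p. n \<ge> N \<Longrightarrow> p \<in> {0..1} \<times> K \<Longrightarrow> norm (F (r n) p - g p) < e"
      using unif by blast
    show "\<exists>N. \<forall>k\<ge>N. norm (infdist x (level_set (u (r k)) \<alpha>) - g (\<alpha>, x)) < e"
      using N[of _ "(\<alpha>, x)"] that by (auto simp: F_def)
  qed
  \<comment> \<open>Candidate for the limit level set: a closed set is recovered from its distance
    function as the zero set.\<close>
  define A where "A \<alpha> = {x \<in> K. g (\<alpha>, x) = 0}" for \<alpha>
  \<comment> \<open>\<open>infdist_limit\<close> needs a point of \<open>K\<close>; a level set
    supplies one.\<close>
  have K_ne: "K \<noteq> {}" using sub[of 0 0] level_set_body(1)[of 0 "u 0"] by auto
  have level_props: "level_set (u k) \<alpha> \<noteq> {}" "closed (level_set (u k) \<alpha>)"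
    "convex (level_set (u k) \<alpha>)" if "\<alpha> \<in> {0..1}" for k \<alpha>
    using level_set_body[OF that, of "u k"] by (auto simp: compact_imp_closed)
  have A_ne: "A \<alpha> \<noteq> {}" if \<alpha>: "\<alpha> \<in> {0..1}" for \<alpha>
  proof -
    obtain x where "x \<in> K" using K_ne by blast
    then have "\<exists>z\<in>K. g (\<alpha>, z) = 0"
      using infdist_limit(1)[where A = "\<lambda>k. level_set (u (r k)) \<alpha>" and g = "\<lambda>x. g (\<alpha>, x)",
          OF K(1) level_props(1,2)[OF \<alpha>] sub[OF \<alpha>] lim[OF \<alpha>]] by blast
    then show ?thesis by (auto simp: A_def)
  qed
  have infdist_A: "infdist x (A \<alpha>) = g (\<alpha>, x)" if "\<alpha> \<in> {0..1}" "x \<in> K" for \<alpha> x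
    unfolding A_def
    by (rule infdist_limit(2)[where A = "\<lambda>k. level_set (u (r k)) \<alpha>" and g = "\<lambda>x. g (\<alpha>, x)",
          OF K(1) level_props(1,2)[OF that(1)] sub[OF that(1)] lim[OF that(1)] that(2)])
  have A_compact: "compact (A \<alpha>)" if \<alpha>: "\<alpha> \<in> {0..1}" for \<alpha>
  proof -
    have "continuous_on K (\<lambda>x. g (\<alpha>, x))"
      using \<alpha> by (intro continuous_on_compose2[OF g]) (auto intro!: continuous_intros)
    then have "closed (A \<alpha>)"
      unfolding A_def by (intro continuous_closed_preimage_constant compact_imp_closed K)
    then show ?thesis
      using compact_Int_closed[OF K(1), of "A \<alpha>"] by (simp add: A_def Int_def)
  qed
  \<comment> \<open>Convexity of distance functions survives the limit, so \<open>g\<close> is at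
    most 0, hence 0, at convex combinations of zeros.\<close>
  have A_convex: "convex (A \<alpha>)" if \<alpha>: "\<alpha> \<in> {0..1}" for \<alpha>
    unfolding convex_def
  proof (intro ballI allI impI)
    fix x y a b assume xy: "x \<in> A \<alpha>" "y \<in> A \<alpha>" and ab: "0 \<le> a" "0 \<le> b" "a + b = (1::real)"
    let ?z = "a *\<^sub>R x + b *\<^sub>R y"
    have x: "x \<in> K" and y: "y \<in> K" using xy by (auto simp: A_def)
    have z: "?z \<in> K" using x y ab by (intro convexD[OF K(2)])
    have "g (\<alpha>, ?z) \<le> a * g (\<alpha>, x) + b * g (\<alpha>, y)"
    proof (rule LIMSEQ_le[OF lim[OF \<alpha> z]])
      show "(\<lambda>k. a * infdist x (level_set (u (r k)) \<alpha>) + b * infdist y (level_set (u (r k)) \<alpha>))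
          \<longlonglongrightarrow> a * g (\<alpha>, x) + b * g (\<alpha>, y)"
        by (intro tendsto_intros lim \<alpha> x y)
    qed (use infdist_convex_combination_le[OF level_props[OF \<alpha>] ab] in blast)
    moreover have "g (\<alpha>, ?z) \<ge> 0"
      using infdist_A[OF \<alpha> z] infdist_nonneg by metis
    ultimately show "?z \<in> A \<alpha>" using xy z by (simp add: A_def)
  qed
  \<comment> \<open>Distances to larger sets are smaller, also in the limit, so a zero of
    \<open>g\<close> at level \<beta> is one at level \<alpha>.\<close>
  have A_mono: "A \<beta> \<subseteq> A \<alpha>" if \<alpha>\<beta>: "0 \<le> \<alpha>" "\<alpha> \<le> \<beta>" "\<beta> \<le> 1" for \<alpha> \<beta>
  proof
    fix x assume x: "x \<in> A \<beta>"
    have \<alpha>: "\<alpha> \<in> {0..1}" and \<beta>: "\<beta> \<in> {0..1}" and xK: "x \<in> K" using \<alpha>\<beta> x by (auto simp: A_def)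
    have "level_set (u k) \<beta> \<subseteq> level_set (u k) \<alpha>" for k
      using \<alpha>\<beta> level_set_subset[OF \<beta>, of "u k"] by (auto simp: level_set_def)
    then have "g (\<alpha>, x) \<le> g (\<beta>, x)"
      using level_props(1)[OF \<beta>]
      by (intro LIMSEQ_le[OF lim[OF \<alpha> xK] lim[OF \<beta> xK]]) (blast intro: infdist_mono)
    moreover have "g (\<alpha>, x) \<ge> 0"
      using infdist_A[OF \<alpha> xK] infdist_nonneg by metis
    ultimately show "x \<in> A \<alpha>" using x by (simp add: A_def)
  qed
  have "continuous_on {0..1} (\<lambda>\<alpha>. infdist t (A \<alpha>))" if "t \<in> A 0" for t
  proof -
    have t: "t \<in> K" using that by (simp add: A_def)
    have "continuous_on {0..1} (\<lambda>\<alpha>. g (\<alpha>, t))"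
      using t by (intro continuous_on_compose2[OF g]) (auto intro!: continuous_intros)
    then show ?thesis by (rule continuous_on_eq) (simp add: infdist_A t)
  qed
  then obtain v where v: "\<And>\<alpha>. \<alpha> \<in> {0..1} \<Longrightarrow> level_set v \<alpha> = A \<alpha>"
    using fuzzy_number_of_levels[of A] A_ne A_compact A_convex A_mono by metis
  have "(u \<circ> r) \<longlonglongrightarrow> v"
    unfolding lim_sequentially
  proof (intro allI impI)
    fix e :: real assume "e > 0"
    then obtain N where N: "\<And>n p. n \<ge> N \<Longrightarrow> p \<in> {0..1} \<times> K \<Longrightarrow> norm (F (r n) p - g p) < e / 2"
      using unif[OF half_gt_zero] by blast
    \<comment> \<open>Uniformity in \<open>(\<alpha>, x)\<close> handles all levels at once;
      \<open>e / 2\<close> leaves room because a supremum keeps only a nonstrict bound.\<close>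
    have "dist (u (r n)) v \<le> e / 2" if n: "n \<ge> N" for n
    proof (rule dist_fuzzy_number_leI)
      fix \<alpha> :: real assume \<alpha>: "\<alpha> \<in> {0..1}"
      show "dist (level (u (r n)) \<alpha>) (level v \<alpha>) \<le> e / 2"
        unfolding dist_level[OF \<alpha> \<alpha>]
      proof (rule hausdorff_dist_leI[of _ _ K])
        fix x assume "x \<in> K"
        then show "\<bar>infdist x (level_set (u (r n)) \<alpha>) - infdist x (level_set v \<alpha>)\<bar> \<le> e / 2"
          using N[OF n, of "(\<alpha>, x)"] \<alpha> by (simp add: F_def v infdist_A)
      next
        show "level_set v \<alpha> \<subseteq> K" by (simp add: v[OF \<alpha>] A_def)
      qed (intro level_set_body sub \<alpha>)+
    qed
    then show "\<exists>N. \<forall>n\<ge>N. dist ((u \<circ> r) n) v < e"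
      using \<open>e > 0\<close> by (intro exI[of _ N]) fastforce
  qed
  with r show thesis by (rule that)
qed

text \<open>The supremum is taken in \<open>ennreal\<close>, where it is 0 for empty
  \<open>B\<close> and infinite for an unbounded family, so the strict bound is meaningful in every
  case.\<close>

theorem theorem5p1:
  fixes B :: "'n::finite fuzzy_number set"
  assumes "B \<subseteq> continuous_fuzzy_numbers"
  shows "compactin (top_of_set continuous_fuzzy_numbers)
           (top_of_set continuous_fuzzy_numbers closure_of B) \<longleftrightarrow>
         (\<exists>M>0. \<forall>u\<in>B. dist u 0 \<le> M) \<and>
         (\<forall>\<epsilon>>0. \<exists>\<delta>>0. \<forall>\<alpha>\<in>{0..1}. \<forall>\<beta>\<in>{0..1}. \<bar>\<alpha> - \<beta>\<bar> < \<delta> \<longrightarrow>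
            (SUP u\<in>B. ennreal (dist (level u \<alpha>) (level u \<beta>))) < ennreal \<epsilon>)"
    (is "?lhs \<longleftrightarrow> ?bounded \<and> ?equi")
proof -
  \<comment> \<open>Since \<open>continuous_fuzzy_numbers\<close> is closed, closures in the
    subspace and in the whole space agree.\<close>
  have cl: "closure B \<subseteq> continuous_fuzzy_numbers"
    using assms closed_continuous_fuzzy_numbers by (rule closure_minimal)
  then have "?lhs \<longleftrightarrow> compact (closure B)"
    using assms by (simp add: compactin_subtopology closure_of_subtopology Int_absorb1)
  also have "\<dots> \<longleftrightarrow> ?bounded \<and> ?equi"
  proof (intro iffI conjI allI impI; (elim conjE)?)
    assume K: "compact (closure B)"
    then have "bounded B"
      by (rule bounded_subset[OF compact_imp_bounded closure_subset])
    then obtain M where "\<forall>u\<in>B. dist 0 u \<le> M"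
      using bounded_any_center[of B 0] by blast
    then show ?bounded
      by (intro exI[of _ "max M 1"]) (auto simp: dist_commute le_max_iff_disj)
  next
    fix \<epsilon> :: real assume K: "compact (closure B)" and "\<epsilon> > 0"
    \<comment> \<open>Uniform continuity, applied to pairs with the same \<open>u\<close>, gives one
      modulus for all of \<open>B\<close>; \<open>\<epsilon> / 2\<close> keeps the supremum strictly
      below \<epsilon>.\<close>
    have uc: "uniformly_continuous_on (closure B \<times> {0..1}) (\<lambda>(u, \<alpha>). level u \<alpha>)"
      using K by (intro compact_uniformly_continuous continuous_on_level_pair cl compact_Times) auto
    obtain d where d: "d > 0" "\<And>p q. p \<in> closure B \<times> {0..1} \<Longrightarrow> q \<in> closure B \<times> {0..1} \<Longrightarrow>
        dist q p < d \<Longrightarrow> dist (case q of (u, \<alpha>) \<Rightarrow> level u \<alpha>) (case p of (u, \<alpha>) \<Rightarrow> level u \<alpha>) < \<epsilon> / 2"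
      using uniformly_continuous_onE[OF uc half_gt_zero[OF \<open>\<epsilon> > 0\<close>]] by blast
    have "(SUP u\<in>B. ennreal (dist (level u \<alpha>) (level u \<beta>))) < ennreal \<epsilon>"
      if \<alpha>\<beta>: "\<alpha> \<in> {0..1}" "\<beta> \<in> {0..1}" "\<bar>\<alpha> - \<beta>\<bar> < d" for \<alpha> \<beta>
    proof -
      have "(SUP u\<in>B. ennreal (dist (level u \<alpha>) (level u \<beta>))) \<le> ennreal (\<epsilon> / 2)"
      proof (intro SUP_least ennreal_leI)
        fix u assume "u \<in> B"
        then have "u \<in> closure B" using closure_subset by blast
        then show "dist (level u \<alpha>) (level u \<beta>) \<le> \<epsilon> / 2"
          using d(2)[of "(u, \<beta>)" "(u, \<alpha>)"] \<alpha>\<beta> by (simp add: dist_Pair_Pair dist_real_def)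
      qed
      also have "\<dots> < ennreal \<epsilon>" using \<open>\<epsilon> > 0\<close> by (intro ennreal_lessI) auto
      finally show ?thesis .
    qed
    then show "\<exists>\<delta>>0. \<forall>\<alpha>\<in>{0..1}. \<forall>\<beta>\<in>{0..1}. \<bar>\<alpha> - \<beta>\<bar> < \<delta> \<longrightarrow>
        (SUP u\<in>B. ennreal (dist (level u \<alpha>) (level u \<beta>))) < ennreal \<epsilon>"
      using d(1) by blast
  next
    assume ?bounded ?equi
    \<comment> \<open>The bound places \<open>B\<close> in a closed ball, hence also
      \<open>closure B\<close>.\<close>
    from \<open>?bounded\<close> obtain M where "B \<subseteq> cball 0 M"
      by (auto simp: subset_iff mem_cball dist_commute)
    then have M: "dist u 0 \<le> M" if "u \<in> closure B" for u
      using that closure_minimal[of B "cball 0 M"] by (auto simp: dist_commute)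
    have equi: "\<exists>d>0. \<forall>u\<in>closure B. \<forall>\<alpha>\<in>{0..1}. \<forall>\<beta>\<in>{0..1}. \<bar>\<alpha> - \<beta>\<bar> < d \<longrightarrow>
        dist (level u \<alpha>) (level u \<beta>) \<le> e" if "e > 0" for e
    proof -
      obtain d where d: "d > 0" "\<And>\<alpha> \<beta>. \<alpha> \<in> {0..1} \<Longrightarrow> \<beta> \<in> {0..1} \<Longrightarrow> \<bar>\<alpha> - \<beta>\<bar> < d \<Longrightarrow>
          (SUP u\<in>B. ennreal (dist (level u \<alpha>) (level u \<beta>))) < ennreal e"
        using \<open>?equi\<close> \<open>e > 0\<close> by blast
      have "dist (level u \<alpha>) (level u \<beta>) \<le> e"
        if u: "u \<in> closure B" and \<alpha>\<beta>: "\<alpha> \<in> {0..1}" "\<beta> \<in> {0..1}" "\<bar>\<alpha> - \<beta>\<bar> < d" for u \<alpha> \<beta>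
      proof -
        have "dist (level w \<alpha>) (level w \<beta>) \<le> e" if "w \<in> B" for w
        proof -
          have "ennreal (dist (level w \<alpha>) (level w \<beta>)) < ennreal e"
            using SUP_upper[OF that, of "\<lambda>u. ennreal (dist (level u \<alpha>) (level u \<beta>))"]
              d(2)[OF \<alpha>\<beta>] by (rule le_less_trans)
          then show ?thesis by (simp add: ennreal_less_iff)
        qed
        \<comment> \<open>At two fixed levels the nonstrict bound is a closed condition on
          \<open>w\<close>, so it passes to \<open>closure B\<close>.\<close>
        then have "B \<subseteq> {w. dist (level w \<alpha>) (level w \<beta>) \<le> e}" by auto
        moreover have "closed {w. dist (level w \<alpha>) (level w \<beta>) \<le> e}"
          by (intro closed_Collect_le continuous_on_dist continuous_on_level \<alpha>\<beta> continuous_on_const)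
        ultimately show ?thesis using u closure_minimal by blast
      qed
      then show ?thesis using d(1) by blast
    qed
    show "compact (closure B)"
      unfolding compact_def
    proof (intro allI impI)
      fix f :: "nat \<Rightarrow> 'n fuzzy_number" assume f: "\<forall>n. f n \<in> closure B"
      obtain v r where r: "strict_mono r" "(f \<circ> r) \<longlonglongrightarrow> v"
      proof (rule fuzzy_number_convergent_subsequence[of f M])
        show "dist (f k) 0 \<le> M" for k using M f by blast
        show "\<exists>d>0. \<forall>k. \<forall>\<alpha>\<in>{0..1}. \<forall>\<beta>\<in>{0..1}. \<bar>\<alpha> - \<beta>\<bar> < d \<longrightarrow>
            dist (level (f k) \<alpha>) (level (f k) \<beta>) \<le> e" if "e > 0" for e
          using equi[OF that] f by blast
      qed
      then have "v \<in> closure B"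
        using f closed_sequentially[OF closed_closure, of "f \<circ> r"] by simp
      then show "\<exists>l\<in>closure B. \<exists>r. strict_mono r \<and> (f \<circ> r) \<longlonglongrightarrow> l"
        using r by blast
    qed
  qed
  finally show ?thesis .
qed

end
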